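(* Let $D_\lambda$ be a sectorial diagonal operator in $\ell^2(J)$ with angle $\theta$ and vertex $0$. Let $f:J\to\mathbb C$ and $g:J\to\mathbb C$ be such that for some $\beta_0>0$, $$\sum_{j\in J}\frac{|f(j)|^2}{(|\lambda_j|^{1/2}+\beta_0)^2}<\infty,\qquad\sum_{j\in J}\frac{|g(j)|^2}{(|\lambda_j|^{1/2}+\beta_0)^2}<\infty.$$ Let $$Q(h,k)=\langle|D_\lambda|^{1/2}h,|D_\lambda|^{1/2}k\rangle,\quad h,k\in\mathscr D(|D_\lambda|^{1/2}),\qquad Q_{f,g}(h,k)=\sum_{j\in J}h(j)\overline{g(j)}\ \sum_{j\in J}f(j)\overline{k(j)}.$$ Then $Q_{f,g}(h,k)$ is defined for all $h,k\in\mathscr D(|D_\lambda|^{1/2})$. Moreover, the form $Q+Q_{f,g}$ is sectorial and there exists a unique sectorial operator $T$ in $\ell^2(J)$ with domain contained in the domain of $Q$ such that $$Q(h,k)+Q_{f,g}(h,k)=\langle Th,k\rangle,\quad h\in\mathscr D(T),\ k\in\mathscr D(Q).$$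
   Context: $J$ is a countably infinite directed set. $D_\lambda$ is the (maximally defined) diagonal operator in $\ell^2(J)$ with diagonal entries $\{\lambda_j:j\in J\}\subseteq\mathbb C$, $D_\lambda e_j=\lambda_je_j$ for the standard orthonormal basis $\{e_j\}$; $|A|$ denotes the modulus of a densely defined closed operator $A$, so $|D_\lambda|^{1/2}$ is the diagonal operator with entries $|\lambda_j|^{1/2}$. The domain of $Q$ is $\mathscr D(Q)=\mathscr D(|D_\lambda|^{1/2})$. A densely defined operator $T$ is sectorial with angle $\theta\in(0,\pi/2)$ and vertex $a\in\mathbb R$ if for some $M\in(0,\infty)$, $\mu\in\rho(T)$ and $\|(T-\mu)^{-1}\|\le\frac{M}{|\mu-a|}$ whenever $\mu\in\mathbb C$ and $|\arg(\mu-a)|\ge\theta$ (this corresponds to Kato's "m-sectorial"). Terminology for sesquilinear forms is as in Kato's Perturbation Theory, Chapter VI: a form $Q$ is sectorial if $\{Q(h,h):\|h\|=1\}$ lies in a sector $\{z:|\arg(z-\gamma)|\le\theta'\}$ with $\gamma\in\mathbb R$, $0\le\theta'<\pi/2$. *)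

theory Defs
  imports "HOL-Analysis.Analysis"
begin

text \<open>
  The index set \<open>J\<close> is the universe of the type \<open>'j\<close>.  Sums over \<open>J\<close> are unordered
  (\<open>summable_on\<close>, \<open>infsum\<close>), which for complex terms is the same as absolute convergence.
  The inner product is linear in its first argument.
\<close>

definition l2 :: "('j \<Rightarrow> complex) set" where
  "l2 = {h. (\<lambda>j. (cmod (h j))\<^sup>2) summable_on UNIV}"

definition l2_inner :: "('j \<Rightarrow> complex) \<Rightarrow> ('j \<Rightarrow> complex) \<Rightarrow> complex" where
  "l2_inner h k = (\<Sum>\<^sub>\<infinity>j. h j * cnj (k j))"

definition l2_norm :: "('j \<Rightarrow> complex) \<Rightarrow> real" where
  "l2_norm h = sqrt (\<Sum>\<^sub>\<infinity>j. (cmod (h j))\<^sup>2)"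

definition l2_subspace :: "('j \<Rightarrow> complex) set \<Rightarrow> bool" where
  "l2_subspace D \<longleftrightarrow> D \<subseteq> l2 \<and> (\<lambda>j. 0) \<in> D \<and>
     (\<forall>h\<in>D. \<forall>k\<in>D. (\<lambda>j. h j + k j) \<in> D) \<and>
     (\<forall>c. \<forall>h\<in>D. (\<lambda>j. c * h j) \<in> D)"

text \<open>
  An unbounded operator is a partial function, so that equality of operators includes equality
  of their domains, and no values outside the domain interfere with uniqueness statements.
\<close>

type_synonym 'j l2_op = "('j \<Rightarrow> complex) \<rightharpoonup> ('j \<Rightarrow> complex)"

definition linear_op :: "'j l2_op \<Rightarrow> bool" where
  "linear_op T \<longleftrightarrow> l2_subspace (dom T) \<and> ran T \<subseteq> l2 \<and>
     (\<forall>h\<in>dom T. \<forall>k\<in>dom T. the (T (\<lambda>j. h j + k j)) = (\<lambda>j. the (T h) j + the (T k) j)) \<and>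
     (\<forall>c. \<forall>h\<in>dom T. the (T (\<lambda>j. c * h j)) = (\<lambda>j. c * the (T h) j))"

definition densely_defined :: "'j l2_op \<Rightarrow> bool" where
  "densely_defined T \<longleftrightarrow> (\<forall>h\<in>l2. \<forall>\<epsilon>>0. \<exists>k\<in>dom T. l2_norm (\<lambda>j. h j - k j) < \<epsilon>)"

definition shift_op :: "'j l2_op \<Rightarrow> complex \<Rightarrow> ('j \<Rightarrow> complex) \<Rightarrow> ('j \<Rightarrow> complex)" where
  "shift_op T \<mu> h = (\<lambda>j. the (T h) j - \<mu> * h j)"

definition resolvent :: "'j l2_op \<Rightarrow> complex \<Rightarrow> ('j \<Rightarrow> complex) \<Rightarrow> ('j \<Rightarrow> complex)" where
  "resolvent T \<mu> = inv_into (dom T) (shift_op T \<mu>)"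

definition resolvent_set :: "'j l2_op \<Rightarrow> complex set" where
  "resolvent_set T = {\<mu>. bij_betw (shift_op T \<mu>) (dom T) l2 \<and>
     (\<exists>C. \<forall>u\<in>l2. l2_norm (resolvent T \<mu> u) \<le> C * l2_norm u)}"

text \<open>Only meaningful for operators that are bounded on all of \<open>l2\<close>.\<close>

definition l2_onorm :: "(('j \<Rightarrow> complex) \<Rightarrow> ('j \<Rightarrow> complex)) \<Rightarrow> real" where
  "l2_onorm R = (SUP u\<in>{u\<in>l2. l2_norm u \<le> 1}. l2_norm (R u))"

text \<open>
  Since \<open>Arg 0 = 0\<close> and \<open>\<theta> > 0\<close>, the resolvent condition does not concern the vertex
  \<open>\<mu> = a\<close> itself.
\<close>

definition sectorial_op_with :: "'j l2_op \<Rightarrow> real \<Rightarrow> real \<Rightarrow> bool" where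
  "sectorial_op_with T \<theta> a \<longleftrightarrow> linear_op T \<and> densely_defined T \<and> 0 < \<theta> \<and> \<theta> < pi / 2 \<and>
     (\<exists>M>0. \<forall>\<mu>. \<bar>Arg (\<mu> - complex_of_real a)\<bar> \<ge> \<theta> \<longrightarrow>
        \<mu> \<in> resolvent_set T \<and>
        l2_onorm (resolvent T \<mu>) \<le> M / cmod (\<mu> - complex_of_real a))"

definition sectorial_op :: "'j l2_op \<Rightarrow> bool" where
  "sectorial_op T \<longleftrightarrow> (\<exists>\<theta> a. sectorial_op_with T \<theta> a)"

definition sesquilinear_form ::
    "('j \<Rightarrow> complex) set \<Rightarrow> (('j \<Rightarrow> complex) \<Rightarrow> ('j \<Rightarrow> complex) \<Rightarrow> complex) \<Rightarrow> bool" where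
  "sesquilinear_form D q \<longleftrightarrow> l2_subspace D \<and>
     (\<forall>h\<in>D. \<forall>h'\<in>D. \<forall>k\<in>D. q (\<lambda>j. h j + h' j) k = q h k + q h' k) \<and>
     (\<forall>c. \<forall>h\<in>D. \<forall>k\<in>D. q (\<lambda>j. c * h j) k = c * q h k) \<and>
     (\<forall>h\<in>D. \<forall>k\<in>D. \<forall>k'\<in>D. q h (\<lambda>j. k j + k' j) = q h k + q h k') \<and>
     (\<forall>c. \<forall>h\<in>D. \<forall>k\<in>D. q h (\<lambda>j. c * k j) = cnj c * q h k)"

text \<open>The vertex \<open>\<gamma>\<close> belongs to the sector, again by \<open>Arg 0 = 0\<close>.\<close>

definition sectorial_form ::
    "('j \<Rightarrow> complex) set \<Rightarrow> (('j \<Rightarrow> complex) \<Rightarrow> ('j \<Rightarrow> complex) \<Rightarrow> complex) \<Rightarrow> bool" where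
  "sectorial_form D q \<longleftrightarrow> sesquilinear_form D q \<and>
     (\<exists>\<gamma> \<theta>. 0 \<le> \<theta> \<and> \<theta> < pi / 2 \<and>
        {q h h |h. h \<in> D \<and> l2_norm h = 1} \<subseteq> {z. \<bar>Arg (z - complex_of_real \<gamma>)\<bar> \<le> \<theta>})"

definition diag_op :: "('j \<Rightarrow> complex) \<Rightarrow> 'j l2_op" where
  "diag_op d = (\<lambda>h. if h \<in> l2 \<and> (\<lambda>j. d j * h j) \<in> l2 then Some (\<lambda>j. d j * h j) else None)"

text \<open>The square root of the modulus of \<open>diag_op d\<close>.\<close>

definition sqrt_abs_diag_op :: "('j \<Rightarrow> complex) \<Rightarrow> 'j l2_op" where
  "sqrt_abs_diag_op d = diag_op (\<lambda>j. complex_of_real (sqrt (cmod (d j))))"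

definition diag_form ::
    "('j \<Rightarrow> complex) \<Rightarrow> ('j \<Rightarrow> complex) \<Rightarrow> ('j \<Rightarrow> complex) \<Rightarrow> complex" where
  "diag_form d h k = l2_inner (the (sqrt_abs_diag_op d h)) (the (sqrt_abs_diag_op d k))"

definition rank_one_form ::
    "('j \<Rightarrow> complex) \<Rightarrow> ('j \<Rightarrow> complex) \<Rightarrow> ('j \<Rightarrow> complex) \<Rightarrow> ('j \<Rightarrow> complex) \<Rightarrow> complex" where
  "rank_one_form f g h k = (\<Sum>\<^sub>\<infinity>j. h j * cnj (g j)) * (\<Sum>\<^sub>\<infinity>j. f j * cnj (k j))"

end

theory Submission
  imports Defs
begin

text \<open>
  The operator can be written down explicitly.  Testing the form identity against the unit
  vectors \<open>e\<^sub>i\<close> forces \<open>T h = |D| h + \<langle>h, g\<rangle> f\<close>, computed coordinatewise, where \<open>|D|\<close> is the diagonal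
  operator with entries \<open>|lam j|\<close>.  So the only candidate up to its domain is \<open>perturbed_op\<close>, this
  formula on all \<open>h\<close> of the form domain for which its value lies in \<open>\<ell>\<^sup>2\<close>.

  The analytic input is a smallness condition after a shift.  With the weight
  \<open>w j = sqrt (|lam j| + R)\<close>, the form domain is \<open>{h. w h \<in> \<ell>\<^sup>2}\<close>, and summability of
  \<open>|f|\<^sup>2 / (sqrt |lam| + \<beta>)\<^sup>2\<close> makes the norm of \<open>f / w\<close> tend to \<open>0\<close> as \<open>R \<rightarrow> \<infinity>\<close>
  (\<open>weighted_norm_small\<close>); likewise for \<open>g\<close>.  Once both norms are at most \<open>1/2\<close>, Cauchy-Schwarz bounds the
  rank-one form at \<open>h\<close> by a quarter of \<open>\<parallel>w h\<parallel>\<^sup>2 = Q(h, h) + R \<parallel>h\<parallel>\<^sup>2\<close>.  This yields a sector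
  with vertex \<open>-R\<close> and half-angle \<open>\<pi>/3\<close> that contains the numerical range
  (\<open>sectorial_perturbed_form\<close>).

  The same smallness inverts \<open>T - \<mu>\<close> for \<open>\<mu>\<close> off the vertex and outside the open
  sector.  Coordinatewise, \<open>T - \<mu>\<close> factors as \<open>(|D| - \<mu>) (1 + K)\<close> with the rank-one map
  \<open>K h = \<langle>h, g\<rangle> (|D| - \<mu>)\<^sup>-\<^sup>1 f\<close>.  The distance from \<open>\<mu>\<close> to \<open>|lam j|\<close> is at least
  half of \<open>w(j)\<^sup>2 + |\<mu> + R|\<close>, so the scalar \<open>\<langle>(|D| - \<mu>)\<^sup>-\<^sup>1 f, g\<rangle>\<close> has modulus at most
  \<open>1/2\<close>, and \<open>1 + K\<close> is inverted by a scalar division (\<open>correction\<close>).  The resulting formula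
  gives the resolvent estimate (\<open>resolvent_estimate\<close>).  It also gives density of the domain: the
  vector \<open>(1 + K)\<^sup>-\<^sup>1 k\<close> lies in the domain for finitely supported \<open>k\<close> and tends to
  \<open>k\<close> as \<open>\<mu> \<rightarrow> -\<infinity>\<close>.

  For uniqueness, the test against unit vectors shows that any competitor is a restriction of
  \<open>perturbed_op\<close>.  For \<open>\<mu>\<close> far to the left the competitor minus \<open>\<mu>\<close> is onto \<open>\<ell>\<^sup>2\<close>
  while \<open>T - \<mu>\<close> is injective, so the restriction is not proper.
\<close>

section \<open>The sequence space\<close>

text \<open>
  Together with its converse \<open>l2_if_L2_set_bounded\<close>, this describes membership and norm in
  \<open>\<ell>\<^sup>2\<close> by the Euclidean norms of finite restrictions, so that the finite triangle and Cauchy-Schwarz inequalities carry over.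
\<close>

lemma L2_set_le_l2_norm:
  assumes "h \<in> l2" "finite F"
  shows "L2_set (\<lambda>j. cmod (h j)) F \<le> l2_norm h"
  using assms unfolding l2_def L2_set_def l2_norm_def
  by (auto intro!: finite_sum_le_infsum)

lemma l2_norm_nonneg: "0 \<le> l2_norm h"
  unfolding l2_norm_def by (simp add: infsum_nonneg)

lemma l2_if_L2_set_bounded:
  assumes bound: "\<And>F. finite F \<Longrightarrow> L2_set (\<lambda>j. cmod (h j)) F \<le> c"
  shows "h \<in> l2" and "l2_norm h \<le> c"
proof -
  have c: "0 \<le> c"
    using bound[of "{}"] by simp
  have sums: "(\<Sum>j\<in>F. (cmod (h j))\<^sup>2) \<le> c\<^sup>2" if "finite F" for F
    using bound[OF that] unfolding L2_set_def by (meson sqrt_le_D)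
  have summable: "(\<lambda>j. (cmod (h j))\<^sup>2) summable_on UNIV"
    by (rule nonneg_bdd_above_summable_on) (use sums in \<open>auto intro!: bdd_aboveI[of _ "c\<^sup>2"]\<close>)
  then show "h \<in> l2"
    by (simp add: l2_def)
  show "l2_norm h \<le> c"
    unfolding l2_norm_def using summable sums c
    by (intro real_le_lsqrt infsum_le_finite_sums) (auto intro: infsum_nonneg)
qed

lemma l2_dominated:
  assumes "k \<in> l2" "0 \<le> c" "\<And>j. cmod (h j) \<le> c * cmod (k j)"
  shows "h \<in> l2" and "l2_norm h \<le> c * l2_norm k"
proof -
  have bound: "L2_set (\<lambda>j. cmod (h j)) F \<le> c * l2_norm k" if "finite F" for F
  proof -
    have "L2_set (\<lambda>j. cmod (h j)) F \<le> L2_set (\<lambda>j. c * cmod (k j)) F"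
      by (rule L2_set_mono) (use assms in auto)
    also have "\<dots> = c * L2_set (\<lambda>j. cmod (k j)) F"
      by (simp add: L2_set_right_distrib \<open>0 \<le> c\<close>)
    also have "\<dots> \<le> c * l2_norm k"
      by (intro mult_left_mono L2_set_le_l2_norm that assms)
    finally show ?thesis .
  qed
  show "h \<in> l2" and "l2_norm h \<le> c * l2_norm k"
    using l2_if_L2_set_bounded[OF bound] by auto
qed

lemma l2_add:
  assumes "h \<in> l2" "k \<in> l2"
  shows "(\<lambda>j. h j + k j) \<in> l2" and "l2_norm (\<lambda>j. h j + k j) \<le> l2_norm h + l2_norm k"
proof -
  have bound: "L2_set (\<lambda>j. cmod (h j + k j)) F \<le> l2_norm h + l2_norm k" if "finite F" for F
  proof -
    have "L2_set (\<lambda>j. cmod (h j + k j)) F \<le> L2_set (\<lambda>j. cmod (h j) + cmod (k j)) F"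
      by (rule L2_set_mono) (auto intro: norm_triangle_ineq)
    also have "\<dots> \<le> L2_set (\<lambda>j. cmod (h j)) F + L2_set (\<lambda>j. cmod (k j)) F"
      by (rule L2_set_triangle_ineq)
    also have "\<dots> \<le> l2_norm h + l2_norm k"
      by (intro add_mono L2_set_le_l2_norm that assms)
    finally show ?thesis .
  qed
  show "(\<lambda>j. h j + k j) \<in> l2" and "l2_norm (\<lambda>j. h j + k j) \<le> l2_norm h + l2_norm k"
    using l2_if_L2_set_bounded[OF bound] by auto
qed

lemma l2_scale:
  assumes "h \<in> l2"
  shows "(\<lambda>j. c * h j) \<in> l2" and "l2_norm (\<lambda>j. c * h j) \<le> cmod c * l2_norm h"
  using l2_dominated[OF assms norm_ge_zero, of "\<lambda>j. c * h j" c] by (simp_all add: norm_mult)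

lemma l2_diff:
  assumes "h \<in> l2" "k \<in> l2"
  shows "(\<lambda>j. h j - k j) \<in> l2" and "l2_norm (\<lambda>j. h j - k j) \<le> l2_norm h + l2_norm k"
proof -
  have k: "(\<lambda>j. - k j) \<in> l2" "l2_norm (\<lambda>j. - k j) \<le> l2_norm k"
    using l2_scale[OF assms(2), of "-1"] by simp_all
  show "(\<lambda>j. h j - k j) \<in> l2" "l2_norm (\<lambda>j. h j - k j) \<le> l2_norm h + l2_norm k"
    using l2_add[OF assms(1) k(1)] k(2) by simp_all
qed

lemma l2_finite_support:
  assumes "finite F" "\<And>j. j \<notin> F \<Longrightarrow> h j = 0"
  shows "h \<in> l2"
proof -
  have "(\<lambda>j. (cmod (h j))\<^sup>2) summable_on UNIV \<longleftrightarrow> (\<lambda>j. (cmod (h j))\<^sup>2) summable_on F"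
    by (rule summable_on_cong_neutral) (use assms in auto)
  then show ?thesis
    using assms(1) by (simp add: l2_def)
qed

lemma l2_truncation:
  assumes h: "h \<in> l2" and "0 < \<epsilon>"
  obtains F where "finite F" "l2_norm (\<lambda>j. h j - (if j \<in> F then h j else 0)) < \<epsilon>"
proof -
  let ?a = "\<lambda>j. (cmod (h j))\<^sup>2"
  have a: "?a summable_on UNIV"
    using h by (simp add: l2_def)
  have "0 < \<epsilon>\<^sup>2 / 2"
    using \<open>0 < \<epsilon>\<close> by simp
  from infsum_finite_approximation[OF a this]
  obtain F where F: "finite F" "dist (sum ?a F) (infsum ?a UNIV) \<le> \<epsilon>\<^sup>2 / 2"
    by blast
  have "infsum (\<lambda>j. (cmod (h j - (if j \<in> F then h j else 0)))\<^sup>2) UNIV = infsum ?a (UNIV - F)"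
    by (rule infsum_cong_neutral) auto
  also have "\<dots> = infsum ?a UNIV - infsum ?a F"
    using a F(1) by (intro infsum_Diff) auto
  also have "\<dots> \<le> \<epsilon>\<^sup>2 / 2"
    using F(2) unfolding dist_real_def infsum_finite[OF F(1)] by linarith
  also have "\<dots> < \<epsilon>\<^sup>2"
    using \<open>0 < \<epsilon>\<close> by simp
  finally have "l2_norm (\<lambda>j. h j - (if j \<in> F then h j else 0)) < sqrt (\<epsilon>\<^sup>2)"
    unfolding l2_norm_def by (rule real_sqrt_less_mono)
  then show ?thesis
    using F(1) \<open>0 < \<epsilon>\<close> that by simp
qed

text \<open>
  Cauchy-Schwarz, for families that are only dominated by a product: a bilinear pairing can then
  be rebalanced between its factors, as in \<open>h \<cdot> g = (w h) \<cdot> (g / w)\<close>, without rewriting the sum.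
\<close>

lemma l2_pairing:
  assumes h: "h \<in> l2" and k: "k \<in> l2"
    and le: "\<And>j. cmod (x j) \<le> cmod (h j) * cmod (k j)"
  shows "x summable_on UNIV" and "cmod (infsum x UNIV) \<le> l2_norm h * l2_norm k"
proof -
  have sums: "(\<Sum>j\<in>F. cmod (x j)) \<le> l2_norm h * l2_norm k" if "finite F" for F
  proof -
    have "(\<Sum>j\<in>F. cmod (x j)) \<le> (\<Sum>j\<in>F. \<bar>cmod (h j)\<bar> * \<bar>cmod (k j)\<bar>)"
      using le by (intro sum_mono) simp
    also have "\<dots> \<le> L2_set (\<lambda>j. cmod (h j)) F * L2_set (\<lambda>j. cmod (k j)) F"
      by (rule L2_set_mult_ineq)
    also have "\<dots> \<le> l2_norm h * l2_norm k"
      by (intro mult_mono L2_set_le_l2_norm that assms) (auto intro: l2_norm_nonneg)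
    finally show ?thesis .
  qed
  have abs: "(\<lambda>j. cmod (x j)) summable_on UNIV"
    by (rule nonneg_bdd_above_summable_on)
      (use sums in \<open>auto intro!: bdd_aboveI[of _ "l2_norm h * l2_norm k"]\<close>)
  then show "x summable_on UNIV"
    by (rule abs_summable_summable)
  have "cmod (infsum x UNIV) \<le> (\<Sum>\<^sub>\<infinity>j. cmod (x j))"
    by (rule norm_infsum_bound[OF abs])
  also have "\<dots> \<le> l2_norm h * l2_norm k"
    by (rule infsum_le_finite_sums[OF abs]) (use sums in auto)
  finally show "cmod (infsum x UNIV) \<le> l2_norm h * l2_norm k" .
qed

section \<open>The form domain as a weighted space\<close>

definition weight :: "('j \<Rightarrow> complex) \<Rightarrow> real \<Rightarrow> 'j \<Rightarrow> real" where
  "weight lam R j = sqrt (cmod (lam j) + R)"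

lemma weight_pos: "0 < R \<Longrightarrow> 0 < weight lam R j"
  by (simp add: weight_def add_nonneg_pos)

lemma weight_sq: "0 < R \<Longrightarrow> (weight lam R j)\<^sup>2 = cmod (lam j) + R"
  by (simp add: weight_def add_nonneg_nonneg)

lemma dom_diag_op: "dom (diag_op d) = {h. h \<in> l2 \<and> (\<lambda>j. d j * h j) \<in> l2}"
  by (auto simp: diag_op_def dom_def)

lemma cmod_weight_mult_sq:
  assumes "0 < R"
  shows "(cmod (complex_of_real (weight lam R j) * z))\<^sup>2 =
    (cmod (complex_of_real (sqrt (cmod (lam j))) * z))\<^sup>2 + R * (cmod z)\<^sup>2"
  using assms by (simp add: norm_mult power_mult_distrib weight_sq distrib_right)

lemma l2_div_weight:
  assumes "u \<in> l2" "0 < R"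
  shows "(\<lambda>j. u j / complex_of_real (weight lam R j)) \<in> l2"
    and "l2_norm (\<lambda>j. u j / complex_of_real (weight lam R j)) \<le> 1 / sqrt R * l2_norm u"
proof -
  have le: "cmod (u j / complex_of_real (weight lam R j)) \<le> 1 / sqrt R * cmod (u j)" for j
  proof -
    have "sqrt R \<le> weight lam R j"
      by (simp add: weight_def)
    then show ?thesis
      using weight_pos[OF assms(2), of lam j] assms(2) by (simp add: norm_divide frac_le)
  qed
  show "(\<lambda>j. u j / complex_of_real (weight lam R j)) \<in> l2"
    and "l2_norm (\<lambda>j. u j / complex_of_real (weight lam R j)) \<le> 1 / sqrt R * l2_norm u"
    using l2_dominated[OF assms(1) _ le] assms(2) by auto
qed

lemma form_domain_eq:
  assumes "0 < R"
  shows "dom (sqrt_abs_diag_op lam) = {h. (\<lambda>j. complex_of_real (weight lam R j) * h j) \<in> l2}"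
proof (intro set_eqI iffI)
  fix h
  assume "h \<in> dom (sqrt_abs_diag_op lam)"
  then show "h \<in> {h. (\<lambda>j. complex_of_real (weight lam R j) * h j) \<in> l2}"
    using assms
    by (auto simp: sqrt_abs_diag_op_def dom_diag_op l2_def cmod_weight_mult_sq
        intro!: summable_on_add summable_on_cmult_right)
next
  fix h
  assume "h \<in> {h. (\<lambda>j. complex_of_real (weight lam R j) * h j) \<in> l2}"
  then have wh: "(\<lambda>j. complex_of_real (weight lam R j) * h j) \<in> l2"
    by simp
  have "h \<in> l2"
  proof (rule l2_dominated(1)[OF wh])
    show "0 \<le> 1 / sqrt R"
      using assms by simp
    show "cmod (h j) \<le> 1 / sqrt R * cmod (complex_of_real (weight lam R j) * h j)" for j
    proof -
      have "sqrt R * cmod (h j) \<le> weight lam R j * cmod (h j)"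
        by (intro mult_right_mono) (auto simp: weight_def)
      then show ?thesis
        using assms weight_pos[OF assms, of lam j] by (simp add: norm_mult field_simps)
    qed
  qed
  moreover have "(\<lambda>j. complex_of_real (sqrt (cmod (lam j))) * h j) \<in> l2"
  proof (rule l2_dominated(1)[OF wh zero_le_one])
    show "cmod (complex_of_real (sqrt (cmod (lam j))) * h j)
        \<le> 1 * cmod (complex_of_real (weight lam R j) * h j)" for j
      using assms weight_pos[OF assms, of lam j]
      by (auto simp: norm_mult weight_def intro!: mult_right_mono)
  qed
  ultimately show "h \<in> dom (sqrt_abs_diag_op lam)"
    by (simp add: sqrt_abs_diag_op_def dom_diag_op)
qed

lemma diag_form_eq:
  assumes "h \<in> dom (sqrt_abs_diag_op lam)" "k \<in> dom (sqrt_abs_diag_op lam)"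
  shows "(\<lambda>j. complex_of_real (cmod (lam j)) * h j * cnj (k j)) summable_on UNIV"
    and "diag_form lam h k = (\<Sum>\<^sub>\<infinity>j. complex_of_real (cmod (lam j)) * h j * cnj (k j))"
proof -
  let ?s = "\<lambda>j. complex_of_real (sqrt (cmod (lam j)))"
  have l2: "(\<lambda>j. ?s j * h j) \<in> l2" "(\<lambda>j. ?s j * k j) \<in> l2"
    using assms by (auto simp: sqrt_abs_diag_op_def dom_diag_op)
  have eq: "?s j * h j * cnj (?s j * k j) = complex_of_real (cmod (lam j)) * h j * cnj (k j)" for j
  proof -
    have "?s j * ?s j = complex_of_real (cmod (lam j))"
      by (simp flip: of_real_mult)
    then show ?thesis
      by (simp add: algebra_simps)
  qed
  show "(\<lambda>j. complex_of_real (cmod (lam j)) * h j * cnj (k j)) summable_on UNIV"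
    using l2_pairing(1)[OF l2, of "\<lambda>j. ?s j * h j * cnj (?s j * k j)"]
    unfolding eq by (simp add: norm_mult flip: eq)
  have "the (sqrt_abs_diag_op lam x) = (\<lambda>j. ?s j * x j)"
    if "x \<in> dom (sqrt_abs_diag_op lam)" for x
    using that by (auto simp: sqrt_abs_diag_op_def diag_op_def dom_def split: if_splits)
  then show "diag_form lam h k = (\<Sum>\<^sub>\<infinity>j. complex_of_real (cmod (lam j)) * h j * cnj (k j))"
    using assms by (simp add: diag_form_def l2_inner_def eq del: complex_cnj_mult)
qed

lemma diag_form_plus_norm:
  assumes "0 < R" "h \<in> dom (sqrt_abs_diag_op lam)"
  shows "diag_form lam h h + complex_of_real (R * (l2_norm h)\<^sup>2) =
    complex_of_real ((l2_norm (\<lambda>j. complex_of_real (weight lam R j) * h j))\<^sup>2)"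
proof -
  let ?s = "\<lambda>j. complex_of_real (sqrt (cmod (lam j)))"
  have h: "(\<lambda>j. (cmod (h j))\<^sup>2) summable_on UNIV"
    and sh: "(\<lambda>j. (cmod (?s j * h j))\<^sup>2) summable_on UNIV"
    using assms by (auto simp: sqrt_abs_diag_op_def dom_diag_op l2_def)
  have "diag_form lam h h = (\<Sum>\<^sub>\<infinity>j. complex_of_real ((cmod (?s j * h j))\<^sup>2))"
    unfolding diag_form_eq(2)[OF assms(2) assms(2)]
    by (intro infsum_cong)
      (simp only: norm_mult norm_of_real power_mult_distrib of_real_mult complex_norm_square mult.assoc, simp)
  also have "\<dots> = complex_of_real (\<Sum>\<^sub>\<infinity>j. (cmod (?s j * h j))\<^sup>2)"
    by (intro infsumI has_sum_of_real has_sum_infsum sh)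
  finally have diag: "diag_form lam h h = complex_of_real (\<Sum>\<^sub>\<infinity>j. (cmod (?s j * h j))\<^sup>2)" .
  have sq: "(l2_norm x)\<^sup>2 = (\<Sum>\<^sub>\<infinity>j. (cmod (x j))\<^sup>2)" for x :: "'a \<Rightarrow> complex"
    unfolding l2_norm_def by (simp add: infsum_nonneg)
  show ?thesis
    unfolding diag sq cmod_weight_mult_sq[OF assms(1)]
    using h sh by (simp add: infsum_add infsum_cmult_right' summable_on_cmult_right flip: of_real_add of_real_mult)
qed

text \<open>
  Split \<open>f\<close> into a finitely supported head and a tail.  The quotient
  \<open>(sqrt |lam| + \<beta>) / w\<close> is at most \<open>2\<close> once \<open>R \<ge> \<beta>\<^sup>2\<close>, so a small tail stays small
  uniformly in \<open>R\<close>; the head divided by \<open>w\<close> decays like \<open>1 / sqrt R\<close>.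
\<close>

lemma weighted_norm_small:
  assumes "0 < \<beta>" and "(\<lambda>j. (cmod (f j))\<^sup>2 / (sqrt (cmod (lam j)) + \<beta>)\<^sup>2) summable_on UNIV"
  obtains R\<^sub>0 where "\<And>R. R\<^sub>0 \<le> R \<Longrightarrow> 0 < R \<Longrightarrow> (\<lambda>j. f j / complex_of_real (weight lam R j)) \<in> l2 \<and>
      l2_norm (\<lambda>j. f j / complex_of_real (weight lam R j)) \<le> 1 / 2"
proof -
  let ?t = "\<lambda>j. sqrt (cmod (lam j)) + \<beta>"
  define \<phi> where "\<phi> j = f j / complex_of_real (?t j)" for j
  have t: "0 < ?t j" for j
    using assms(1) by (simp add: add_nonneg_pos)
  have \<phi>: "\<phi> \<in> l2"
    using assms(2) by (simp add: l2_def \<phi>_def norm_divide power_divide flip: of_real_add)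
  obtain F where F: "finite F" "l2_norm (\<lambda>j. \<phi> j - (if j \<in> F then \<phi> j else 0)) < 1 / 8"
    using l2_truncation[OF \<phi>, of "1 / 8"] by auto
  \<comment> \<open>Division by \<open>w\<close> will at most double the tail relative to \<open>\<phi>\<close>, so that head and tail each
    contribute at most \<open>1/4\<close>.\<close>
  define tail where "tail j = \<phi> j - (if j \<in> F then \<phi> j else 0)" for j
  define head where "head j = (if j \<in> F then f j else 0)" for j
  have head: "head \<in> l2"
    by (rule l2_finite_support[OF F(1)]) (simp add: head_def)
  have tail: "tail \<in> l2"
    unfolding tail_def
    by (rule l2_diff(1)[OF \<phi> l2_finite_support[OF F(1)]]) simp
  have "(\<lambda>j. f j / complex_of_real (weight lam R j)) \<in> l2 \<and>
      l2_norm (\<lambda>j. f j / complex_of_real (weight lam R j)) \<le> 1 / 2"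
    if R: "max (\<beta>\<^sup>2) ((4 * l2_norm head)\<^sup>2) \<le> R" "0 < R" for R
  proof -
    let ?w = "weight lam R"
    have w: "0 < ?w j" for j
      using weight_pos[OF \<open>0 < R\<close>] .
    have tw: "?t j \<le> 2 * ?w j" for j
    proof -
      have "(?t j)\<^sup>2 \<le> 2 * ((sqrt (cmod (lam j)))\<^sup>2 + \<beta>\<^sup>2)"
        using sum_squares_bound[of "sqrt (cmod (lam j))" \<beta>] by (simp add: power2_sum)
      also have "\<dots> \<le> (2 * ?w j)\<^sup>2"
      proof -
        have "\<beta>\<^sup>2 \<le> R"
          using R by simp
        then have "2 * (cmod (lam j) + \<beta>\<^sup>2) \<le> 4 * (cmod (lam j) + R)"
          using \<open>0 < R\<close> norm_ge_zero[of "lam j"] by argo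
        then show ?thesis
          by (simp add: power_mult_distrib weight_sq[OF \<open>0 < R\<close>])
      qed
      finally show ?thesis
        using w[of j] by (meson less_imp_le power2_le_imp_le mult_nonneg_nonneg zero_le_numeral)
    qed
    note h1 = l2_div_weight[OF head \<open>0 < R\<close>, of lam]
    have "4 * l2_norm head \<le> sqrt R"
      using R by (auto intro!: real_le_rsqrt)
    then have h2: "1 / sqrt R * l2_norm head \<le> 1 / 4"
      using \<open>0 < R\<close> by (simp add: field_simps)
    have t1: "(\<lambda>j. f j / complex_of_real (?w j) - head j / complex_of_real (?w j)) \<in> l2"
      "l2_norm (\<lambda>j. f j / complex_of_real (?w j) - head j / complex_of_real (?w j)) \<le> 2 * l2_norm tail"
    proof -
      have le: "cmod (f j / complex_of_real (?w j) - head j / complex_of_real (?w j)) \<le> 2 * cmod (tail j)" for j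
      proof (cases "j \<in> F")
        case False
        have "?t j * cmod (f j) \<le> 2 * ?w j * cmod (f j)"
          using tw by (intro mult_right_mono) auto
        then show ?thesis
          using False w[of j] t[of j]
          by (simp add: head_def tail_def \<phi>_def norm_divide field_simps flip: of_real_add)
      qed (simp add: head_def)
      show "(\<lambda>j. f j / complex_of_real (?w j) - head j / complex_of_real (?w j)) \<in> l2"
        "l2_norm (\<lambda>j. f j / complex_of_real (?w j) - head j / complex_of_real (?w j)) \<le> 2 * l2_norm tail"
        by (rule l2_dominated[OF tail _ le], simp)+
    qed
    show ?thesis
    proof -
      have "l2_norm tail < 1 / 8"
        using F(2) unfolding tail_def[abs_def] .
      then have "l2_norm (\<lambda>j. f j / complex_of_real (?w j)) \<le> 1 / 2"
        using l2_add(2)[OF t1(1) h1(1)] h1(2) h2 t1(2) unfolding diff_add_cancel by linarith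
      then show ?thesis
        using l2_add(1)[OF t1(1) h1(1)] by simp
    qed
  qed
  then show ?thesis
    using that by blast
qed

section \<open>The sector of half-angle pi/3\<close>

text \<open>
  The angle \<open>\<pi>/3\<close> is convenient because its cosine is \<open>1/2\<close>.  The first lemma is used
  in both directions: as a bound off the sector and, contrapositively, to place values inside it.
\<close>

lemma Re_le_half_norm_if_Arg_ge:
  assumes "pi / 3 \<le> \<bar>Arg z\<bar>"
  shows "z \<noteq> 0" and "Re z \<le> cmod z / 2"
proof -
  show z: "z \<noteq> 0"
    using assms pi_gt_zero by (auto simp: Arg_zero simp del: pi_gt_zero)
  have "cos \<bar>Arg z\<bar> \<le> cos (pi / 3)"
    using assms Arg_bounded[of z] by (intro cos_monotone_0_pi_le) auto
  then have "cos (Arg z) \<le> 1 / 2"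
    by (simp add: cos_60)
  then have "cmod z * cos (Arg z) \<le> cmod z * (1 / 2)"
    by (intro mult_left_mono) auto
  then show "Re z \<le> cmod z / 2"
    using z by (simp add: cos_Arg)
qed

lemma dist_sector_ge:
  assumes "pi / 3 \<le> \<bar>Arg z\<bar>" "0 \<le> t"
  shows "(t + cmod z) / 2 \<le> cmod (complex_of_real t - z)"
proof (rule power2_le_imp_le)
  have "t * Re z \<le> t * (cmod z / 2)"
    using Re_le_half_norm_if_Arg_ge(2)[OF assms(1)] assms(2) by (rule mult_left_mono)
  moreover have "(cmod (complex_of_real t - z))\<^sup>2 = t\<^sup>2 - 2 * (t * Re z) + (cmod z)\<^sup>2"
    unfolding cmod_power2 by (simp add: power2_eq_square algebra_simps)
  moreover have "0 \<le> (t - cmod z)\<^sup>2"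
    by simp
  ultimately show "((t + cmod z) / 2)\<^sup>2 \<le> (cmod (complex_of_real t - z))\<^sup>2"
    by (simp add: power2_eq_square field_simps)
qed simp


section \<open>The perturbed operator\<close>

locale small_rank_one_perturbation =
  fixes lam f g :: "'j \<Rightarrow> complex" and R :: real
  assumes R_pos: "0 < R"
    and f_weighted: "(\<lambda>j. f j / complex_of_real (weight lam R j)) \<in> l2"
    and f_small: "l2_norm (\<lambda>j. f j / complex_of_real (weight lam R j)) \<le> 1 / 2"
    and g_weighted: "(\<lambda>j. g j / complex_of_real (weight lam R j)) \<in> l2"
    and g_small: "l2_norm (\<lambda>j. g j / complex_of_real (weight lam R j)) \<le> 1 / 2"
begin

abbreviation w :: "'j \<Rightarrow> complex" where
  "w j \<equiv> complex_of_real (weight lam R j)"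

definition form_domain :: "('j \<Rightarrow> complex) set" where
  "form_domain = {h. (\<lambda>j. w j * h j) \<in> l2}"

text \<open>The pairing with \<open>g\<close>; it need not be bounded for the norm of \<open>\<ell>\<^sup>2\<close>.\<close>

definition functional :: "('j \<Rightarrow> complex) \<Rightarrow> complex" where
  "functional h = (\<Sum>\<^sub>\<infinity>j. h j * cnj (g j))"

definition perturbed_op :: "'j l2_op" where
  "perturbed_op = (\<lambda>h. let v = \<lambda>j. complex_of_real (cmod (lam j)) * h j + functional h * f j
     in if h \<in> form_domain \<and> v \<in> l2 then Some v else None)"

lemma wpos: "0 < weight lam R j"
  using R_pos by (rule weight_pos)

lemma w_nz [simp]: "weight lam R j \<noteq> 0"
  using wpos[of j] by simp

lemma form_domain_dom: "dom (sqrt_abs_diag_op lam) = form_domain"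
  unfolding form_domain_def by (rule form_domain_eq[OF R_pos])

lemma form_domain_l2: "form_domain \<subseteq> l2"
  by (auto simp: sqrt_abs_diag_op_def dom_diag_op simp flip: form_domain_dom)

lemma form_domain_add: "h \<in> form_domain \<Longrightarrow> k \<in> form_domain \<Longrightarrow> (\<lambda>j. h j + k j) \<in> form_domain"
  using l2_add(1)[of "\<lambda>j. w j * h j" "\<lambda>j. w j * k j"] by (simp add: form_domain_def distrib_left)

lemma form_domain_scale: "h \<in> form_domain \<Longrightarrow> (\<lambda>j. c * h j) \<in> form_domain"
  using l2_scale(1)[of "\<lambda>j. w j * h j" c] by (simp add: form_domain_def mult.left_commute)

lemma subspace_form_domain: "l2_subspace form_domain"
  unfolding l2_subspace_def
  using form_domain_l2 form_domain_add form_domain_scale l2_finite_support[of "{}" "\<lambda>_. 0"]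
  by (auto simp: form_domain_def)

lemma form_domain_finite_support:
  "finite F \<Longrightarrow> (\<And>j. j \<notin> F \<Longrightarrow> h j = 0) \<Longrightarrow> h \<in> form_domain"
  unfolding form_domain_def by (auto intro: l2_finite_support)

lemma pairing_g:
  assumes "h \<in> form_domain"
  shows "(\<lambda>j. h j * cnj (g j)) summable_on UNIV"
    and "cmod (functional h) \<le> l2_norm (\<lambda>j. w j * h j) / 2"
proof -
  have wh: "(\<lambda>j. w j * h j) \<in> l2"
    using assms by (simp add: form_domain_def)
  have le: "cmod (h j * cnj (g j)) \<le> cmod (w j * h j) * cmod (g j / w j)" for j
    by (simp add: norm_mult norm_divide)
  show "(\<lambda>j. h j * cnj (g j)) summable_on UNIV"
    by (rule l2_pairing(1)[OF wh g_weighted le])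
  have "cmod (functional h) \<le> l2_norm (\<lambda>j. w j * h j) * l2_norm (\<lambda>j. g j / w j)"
    unfolding functional_def by (rule l2_pairing(2)[OF wh g_weighted le])
  also have "\<dots> \<le> l2_norm (\<lambda>j. w j * h j) * (1 / 2)"
    by (intro mult_left_mono g_small l2_norm_nonneg)
  finally show "cmod (functional h) \<le> l2_norm (\<lambda>j. w j * h j) / 2"
    by simp
qed

lemma pairing_f:
  assumes "k \<in> form_domain"
  shows "(\<lambda>j. f j * cnj (k j)) summable_on UNIV"
    and "cmod (\<Sum>\<^sub>\<infinity>j. f j * cnj (k j)) \<le> l2_norm (\<lambda>j. w j * k j) / 2"
proof -
  have wk: "(\<lambda>j. w j * k j) \<in> l2"
    using assms by (simp add: form_domain_def)
  have le: "cmod (f j * cnj (k j)) \<le> cmod (w j * k j) * cmod (f j / w j)" for j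
    by (simp add: norm_mult norm_divide)
  show "(\<lambda>j. f j * cnj (k j)) summable_on UNIV"
    by (rule l2_pairing(1)[OF wk f_weighted le])
  have "cmod (\<Sum>\<^sub>\<infinity>j. f j * cnj (k j)) \<le> l2_norm (\<lambda>j. w j * k j) * l2_norm (\<lambda>j. f j / w j)"
    by (rule l2_pairing(2)[OF wk f_weighted le])
  also have "\<dots> \<le> l2_norm (\<lambda>j. w j * k j) * (1 / 2)"
    by (intro mult_left_mono f_small l2_norm_nonneg)
  finally show "cmod (\<Sum>\<^sub>\<infinity>j. f j * cnj (k j)) \<le> l2_norm (\<lambda>j. w j * k j) / 2"
    by simp
qed

lemma functional_add:
  assumes "h \<in> form_domain" "k \<in> form_domain"
  shows "functional (\<lambda>j. h j + k j) = functional h + functional k"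
  unfolding functional_def
  using infsum_add[OF pairing_g(1)[OF assms(1)] pairing_g(1)[OF assms(2)]]
  by (simp add: distrib_right)

lemma functional_scale: "functional (\<lambda>j. c * h j) = c * functional h"
  unfolding functional_def by (simp add: infsum_cmult_right' mult.assoc)

lemma rank_one_form_eq: "rank_one_form f g h k = functional h * (\<Sum>\<^sub>\<infinity>j. f j * cnj (k j))"
  by (simp add: rank_one_form_def functional_def)

lemma perturbed_op_dom:
  "dom perturbed_op = {h \<in> form_domain.
     (\<lambda>j. complex_of_real (cmod (lam j)) * h j + functional h * f j) \<in> l2}"
  by (auto simp: perturbed_op_def Let_def dom_def)

lemma perturbed_op_apply:
  "h \<in> dom perturbed_op \<Longrightarrow>
     the (perturbed_op h) = (\<lambda>j. complex_of_real (cmod (lam j)) * h j + functional h * f j)"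
  by (auto simp: perturbed_op_def Let_def dom_def)

lemma linear_perturbed_op: "linear_op perturbed_op"
proof -
  let ?v = "\<lambda>h j. complex_of_real (cmod (lam j)) * h j + functional h * f j"
  have add_eq: "?v (\<lambda>j. h j + k j) = (\<lambda>j. ?v h j + ?v k j)"
    if "h \<in> dom perturbed_op" "k \<in> dom perturbed_op" for h k
    using that by (simp add: perturbed_op_dom functional_add algebra_simps)
  have scale_eq: "?v (\<lambda>j. c * h j) = (\<lambda>j. c * ?v h j)" for c h
    by (simp add: functional_scale algebra_simps)
  have add: "(\<lambda>j. h j + k j) \<in> dom perturbed_op"
    if "h \<in> dom perturbed_op" "k \<in> dom perturbed_op" for h k
    using that add_eq[OF that] l2_add(1)[of "?v h" "?v k"] form_domain_add[of h k]
    by (simp add: perturbed_op_dom)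
  have scale: "(\<lambda>j. c * h j) \<in> dom perturbed_op" if "h \<in> dom perturbed_op" for c h
    using that l2_scale(1)[of "?v h" c] form_domain_scale[of h c]
    unfolding perturbed_op_dom mem_Collect_eq scale_eq by auto
  have zero: "(\<lambda>j. 0) \<in> dom perturbed_op"
    using subspace_form_domain by (auto simp: perturbed_op_dom l2_subspace_def functional_def
        intro: l2_finite_support[of "{}"])
  have "ran perturbed_op \<subseteq> l2"
    by (auto simp: perturbed_op_def Let_def ran_def split: if_splits)
  moreover have "dom perturbed_op \<subseteq> l2"
    using form_domain_l2 by (auto simp: perturbed_op_dom)
  ultimately show ?thesis
    unfolding linear_op_def l2_subspace_def
    using add scale zero by (auto simp: perturbed_op_apply add_eq scale_eq)
qed

lemma perturbed_op_represents_form: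
  assumes "h \<in> dom perturbed_op" "k \<in> form_domain"
  shows "diag_form lam h k + rank_one_form f g h k = l2_inner (the (perturbed_op h)) k"
proof -
  have h: "h \<in> form_domain"
    using assms(1) by (simp add: perturbed_op_dom)
  have hk: "h \<in> dom (sqrt_abs_diag_op lam)" "k \<in> dom (sqrt_abs_diag_op lam)"
    using h assms(2) by (simp_all add: form_domain_dom)
  have "l2_inner (the (perturbed_op h)) k
    = (\<Sum>\<^sub>\<infinity>j. complex_of_real (cmod (lam j)) * h j * cnj (k j) + functional h * (f j * cnj (k j)))"
    unfolding l2_inner_def perturbed_op_apply[OF assms(1)] by (simp add: algebra_simps)
  also have "\<dots> = diag_form lam h k + functional h * (\<Sum>\<^sub>\<infinity>j. f j * cnj (k j))"
    unfolding diag_form_eq(2)[OF hk] infsum_cmult_right'[symmetric]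
    by (intro infsum_add diag_form_eq(1)[OF hk] summable_on_cmult_right pairing_f(1)[OF assms(2)])
  finally show ?thesis
    by (simp add: rank_one_form_eq)
qed

lemma sectorial_perturbed_form:
  "sectorial_form form_domain (\<lambda>h k. diag_form lam h k + rank_one_form f g h k)"
proof -
  let ?q = "\<lambda>h k. diag_form lam h k + rank_one_form f g h k"
  let ?d = "\<lambda>j. complex_of_real (cmod (lam j))"
  have diag: "(\<lambda>j. ?d j * h j * cnj (k j)) summable_on UNIV"
    "diag_form lam h k = (\<Sum>\<^sub>\<infinity>j. ?d j * h j * cnj (k j))"
    if "h \<in> form_domain" "k \<in> form_domain" for h k
    using diag_form_eq[of h lam k] that by (simp_all add: form_domain_dom)
  have "?q (\<lambda>j. h j + h' j) k = ?q h k + ?q h' k"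
    if "h \<in> form_domain" "h' \<in> form_domain" "k \<in> form_domain" for h h' k
  proof -
    have "diag_form lam (\<lambda>j. h j + h' j) k = diag_form lam h k + diag_form lam h' k"
      using infsum_add[OF diag(1)[OF that(1,3)] diag(1)[OF that(2,3)]] that
      by (simp add: diag(2) form_domain_add algebra_simps)
    then show ?thesis
      using that by (simp add: rank_one_form_eq functional_add algebra_simps)
  qed
  moreover have "?q (\<lambda>j. c * h j) k = c * ?q h k"
    if "h \<in> form_domain" "k \<in> form_domain" for c h k
  proof -
    have "diag_form lam (\<lambda>j. c * h j) k = c * diag_form lam h k"
      using that by (simp add: diag(2) form_domain_scale mult.left_commute mult.assoc flip: infsum_cmult_right')
    then show ?thesis
      by (simp add: rank_one_form_eq functional_scale algebra_simps)
  qed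
  moreover have "?q h (\<lambda>j. k j + k' j) = ?q h k + ?q h k'"
    if "h \<in> form_domain" "k \<in> form_domain" "k' \<in> form_domain" for h k k'
  proof -
    have "diag_form lam h (\<lambda>j. k j + k' j) = diag_form lam h k + diag_form lam h k'"
      using infsum_add[OF diag(1)[OF that(1,2)] diag(1)[OF that(1,3)]] that
      by (simp add: diag(2) form_domain_add algebra_simps)
    moreover have "(\<Sum>\<^sub>\<infinity>j. f j * cnj (k j + k' j)) = (\<Sum>\<^sub>\<infinity>j. f j * cnj (k j)) + (\<Sum>\<^sub>\<infinity>j. f j * cnj (k' j))"
      using infsum_add[OF pairing_f(1)[OF that(2)] pairing_f(1)[OF that(3)]]
      by (simp add: algebra_simps)
    ultimately show ?thesis
      by (simp only: rank_one_form_eq) (simp add: algebra_simps)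
  qed
  moreover have "?q h (\<lambda>j. c * k j) = cnj c * ?q h k"
    if "h \<in> form_domain" "k \<in> form_domain" for c h k
  proof -
    have "diag_form lam h (\<lambda>j. c * k j) = cnj c * diag_form lam h k"
      using that by (simp add: diag(2) form_domain_scale mult.left_commute flip: infsum_cmult_right')
    moreover have "(\<Sum>\<^sub>\<infinity>j. f j * cnj (c * k j)) = cnj c * (\<Sum>\<^sub>\<infinity>j. f j * cnj (k j))"
      by (simp add: mult.left_commute flip: infsum_cmult_right')
    ultimately show ?thesis
      by (simp only: rank_one_form_eq) (simp add: algebra_simps)
  qed
  ultimately have "sesquilinear_form form_domain ?q"
    unfolding sesquilinear_form_def using subspace_form_domain by blast
  moreover have "\<bar>Arg (?q h h - complex_of_real (- R))\<bar> \<le> pi / 3"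
    if h: "h \<in> form_domain" "l2_norm h = 1" for h
  proof (rule ccontr)
    assume "\<not> ?thesis"
    then have arg: "pi / 3 \<le> \<bar>Arg (?q h h - complex_of_real (- R))\<bar>"
      by simp
    define N where "N = (l2_norm (\<lambda>j. w j * h j))\<^sup>2"
    define z where "z = rank_one_form f g h h"
    have "diag_form lam h h + complex_of_real R = complex_of_real N"
      using diag_form_plus_norm[OF R_pos, of h lam] h by (simp add: form_domain_dom N_def)
    then have eq: "?q h h - complex_of_real (- R) = complex_of_real N + z"
      by (simp add: z_def algebra_simps)
    \<comment> \<open>The rank-one part is at most \<open>N/4\<close>: the real part is at least \<open>3N/4\<close> and the modulus at
      most \<open>5N/4\<close>, too little for a point off the sector.\<close>
    have "cmod z \<le> (l2_norm (\<lambda>j. w j * h j) / 2) * (l2_norm (\<lambda>j. w j * h j) / 2)"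
      unfolding z_def rank_one_form_eq norm_mult
      by (intro mult_mono pairing_g(2) pairing_f(2) h) (auto simp: l2_norm_nonneg)
    then have z: "cmod z \<le> N / 4"
      by (simp add: N_def power2_eq_square)
    have N: "0 \<le> N"
      by (simp add: N_def)
    have "Re (complex_of_real N + z) \<le> cmod (complex_of_real N + z) / 2"
      and nz: "complex_of_real N + z \<noteq> 0"
      using Re_le_half_norm_if_Arg_ge[OF arg] by (simp_all only: eq) auto
    moreover have "cmod (complex_of_real N + z) \<le> N + cmod z"
      using norm_triangle_ineq[of "complex_of_real N" z] N by simp
    moreover have "- cmod z \<le> Re z"
      using abs_Re_le_cmod[of z] by linarith
    ultimately have "N = 0"
      using z N by simp
    with z nz show False
      by simp
  qed
  ultimately show ?thesis
    unfolding sectorial_form_def by (intro conjI exI[of _ "- R"] exI[of _ "pi / 3"]) auto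
qed

section \<open>The resolvent\<close>

context
  fixes \<mu> :: complex
  assumes off_sector: "pi / 3 \<le> \<bar>Arg (\<mu> - complex_of_real (- R))\<bar>"
begin

abbreviation \<nu> :: real where
  "\<nu> \<equiv> cmod (\<mu> - complex_of_real (- R))"

abbreviation p :: "'j \<Rightarrow> complex" where
  "p j \<equiv> complex_of_real (cmod (lam j)) - \<mu>"

text \<open>
  The Sherman-Morrison formula for \<open>(1 + K)\<^sup>-\<^sup>1\<close>, where \<open>K\<close> maps \<open>h\<close> to
  \<open>functional h\<close> times \<open>f / p\<close>.
\<close>

definition correction :: "('j \<Rightarrow> complex) \<Rightarrow> ('j \<Rightarrow> complex)" where
  "correction k = (\<lambda>j. k j - functional k / (1 + functional (\<lambda>i. f i / p i)) * (f j / p j))"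

lemma nu_pos: "0 < \<nu>"
  using Re_le_half_norm_if_Arg_ge(1)[OF off_sector] by simp

lemma p_ge: "((weight lam R j)\<^sup>2 + \<nu>) / 2 \<le> cmod (p j)"
proof -
  have "complex_of_real ((weight lam R j)\<^sup>2) - (\<mu> - complex_of_real (- R)) = p j"
    unfolding weight_sq[OF R_pos] by simp
  then show ?thesis
    using dist_sector_ge[OF off_sector, of "(weight lam R j)\<^sup>2"] by (simp only:) simp
qed

lemma p_nz [simp]: "complex_of_real (cmod (lam j)) \<noteq> \<mu>"
proof -
  have "0 < ((weight lam R j)\<^sup>2 + \<nu>) / 2"
    using nu_pos by (simp add: add_nonneg_pos)
  with p_ge[of j] show ?thesis
    by auto
qed

text \<open>
  Dividing by \<open>p\<close> gains a factor \<open>w\<^sup>2\<close>, which takes \<open>f / w \<in> \<ell>\<^sup>2\<close> to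
  \<open>w (f / p) \<in> \<ell>\<^sup>2\<close>.  If only one factor \<open>w\<close> is spent, the arithmetic-geometric mean
  \<open>2 w sqrt \<nu> \<le> w\<^sup>2 + \<nu>\<close> leaves decay of order \<open>1 / sqrt \<nu>\<close>; two such factors, one from
  \<open>f\<close> and one from \<open>g\<close>, make up the decay \<open>1 / \<nu>\<close> required of the resolvent.
\<close>

lemma weighted_div_p:
  assumes "(\<lambda>j. x j / w j) \<in> l2"
  shows "(\<lambda>j. x j / p j) \<in> form_domain"
    and "l2_norm (\<lambda>j. w j * (x j / p j)) \<le> 2 * l2_norm (\<lambda>j. x j / w j)"
proof -
  have le: "cmod (w j * (x j / p j)) \<le> 2 * cmod (x j / w j)" for j
  proof -
    have "weight lam R j * weight lam R j \<le> 2 * cmod (p j)"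
      using p_ge[of j] nu_pos unfolding power2_eq_square by argo
    then have "cmod (x j) * (weight lam R j * weight lam R j) \<le> cmod (x j) * (2 * cmod (p j))"
      by (intro mult_left_mono) auto
    then show ?thesis
      using wpos[of j] p_nz[of j] by (simp add: norm_mult norm_divide field_simps del: p_nz)
  qed
  show "(\<lambda>j. x j / p j) \<in> form_domain"
    "l2_norm (\<lambda>j. w j * (x j / p j)) \<le> 2 * l2_norm (\<lambda>j. x j / w j)"
    using l2_dominated[OF assms _ le] by (auto simp: form_domain_def)
qed

lemma norm_div_p:
  assumes "(\<lambda>j. x j / w j) \<in> l2"
  shows "(\<lambda>j. x j / p j) \<in> l2"
    and "l2_norm (\<lambda>j. x j / p j) \<le> l2_norm (\<lambda>j. x j / w j) / sqrt \<nu>"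
proof -
  have le: "cmod (x j / p j) \<le> 1 / sqrt \<nu> * cmod (x j / w j)" for j
  proof -
    have "2 * weight lam R j * sqrt \<nu> \<le> (weight lam R j)\<^sup>2 + (sqrt \<nu>)\<^sup>2"
      by (rule sum_squares_bound)
    then have "weight lam R j * sqrt \<nu> \<le> cmod (p j)"
      using p_ge[of j] by simp
    then have "cmod (x j) * (weight lam R j * sqrt \<nu>) \<le> cmod (x j) * cmod (p j)"
      by (intro mult_left_mono) auto
    then show ?thesis
      using wpos[of j] p_nz[of j] nu_pos by (simp add: norm_mult norm_divide field_simps del: p_nz)
  qed
  show "(\<lambda>j. x j / p j) \<in> l2"
    "l2_norm (\<lambda>j. x j / p j) \<le> l2_norm (\<lambda>j. x j / w j) / sqrt \<nu>"
    using l2_dominated[OF assms _ le] nu_pos by auto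
qed

lemma functional_f_div_p: "cmod (functional (\<lambda>j. f j / p j)) \<le> 1 / 2"
  using pairing_g(2)[OF weighted_div_p(1)[OF f_weighted]] weighted_div_p(2)[OF f_weighted] f_small
  by linarith

lemma denominator: "1 / 2 \<le> cmod (1 + functional (\<lambda>j. f j / p j))"
  using functional_f_div_p norm_triangle_ineq2[of 1 "- functional (\<lambda>j. f j / p j)"] by simp

lemma denominator_nz: "1 + functional (\<lambda>j. f j / p j) \<noteq> 0"
  using denominator by auto

lemma correction_form_domain:
  assumes "k \<in> form_domain"
  shows "correction k \<in> form_domain"
    and "functional (correction k) = functional k / (1 + functional (\<lambda>j. f j / p j))"
proof -
  define c where "c = functional k / (1 + functional (\<lambda>i. f i / p i))"
  have eq: "correction k = (\<lambda>j. k j + (- c) * (f j / p j))"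
    by (simp add: correction_def c_def)
  have fp: "(\<lambda>j. (- c) * (f j / p j)) \<in> form_domain"
    by (rule form_domain_scale[OF weighted_div_p(1)[OF f_weighted]])
  show "correction k \<in> form_domain"
    unfolding eq by (rule form_domain_add[OF assms fp])
  have "functional (correction k) = functional k + (- c) * functional (\<lambda>j. f j / p j)"
    unfolding eq functional_add[OF assms fp] functional_scale ..
  also have "\<dots> = c"
    using denominator_nz by (simp add: c_def field_simps)
  finally show "functional (correction k) = functional k / (1 + functional (\<lambda>j. f j / p j))"
    by (simp add: c_def)
qed

text \<open>
  The factorisation \<open>T - \<mu> = (|D| - \<mu>) (1 + K)\<close>, in coordinates and before asking whether the
  vectors involved lie in \<open>\<ell>\<^sup>2\<close>.
\<close>

lemma correction_equation:
  assumes "k \<in> form_domain"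
  shows "p j * correction k j + functional (correction k) * f j = p j * k j"
proof -
  have cancel: "p j * (c * (f j / p j)) = c * f j" for c
    by simp
  show ?thesis
    unfolding correction_form_domain(2)[OF assms]
    unfolding correction_def right_diff_distrib cancel by simp
qed

lemma perturbed_op_correction:
  assumes k: "k \<in> form_domain" and pk: "(\<lambda>j. p j * k j) \<in> l2"
  shows "correction k \<in> dom perturbed_op"
    and "shift_op perturbed_op \<mu> (correction k) = (\<lambda>j. p j * k j)"
proof -
  have eq: "complex_of_real (cmod (lam j)) * correction k j + functional (correction k) * f j
      = p j * k j + \<mu> * correction k j" for j
    using correction_equation[OF k, of j] by (simp add: algebra_simps)
  have "(\<lambda>j. p j * k j + \<mu> * correction k j) \<in> l2"
    using correction_form_domain(1)[OF k] form_domain_l2 by (intro l2_add pk l2_scale) auto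
  then show dom: "correction k \<in> dom perturbed_op"
    using correction_form_domain(1)[OF k] by (simp add: perturbed_op_dom eq)
  show "shift_op perturbed_op \<mu> (correction k) = (\<lambda>j. p j * k j)"
    by (simp add: shift_op_def perturbed_op_apply[OF dom] eq)
qed

text \<open>
  Pairing \<open>(T - \<mu>) h / p = (1 + K) h\<close> with \<open>g\<close> recovers \<open>functional h\<close>, hence \<open>h\<close>, since
  the scalar denominator does not vanish.
\<close>

lemma inverse_shift:
  assumes "h \<in> dom perturbed_op"
  shows "correction (\<lambda>j. shift_op perturbed_op \<mu> h j / p j) = h"
proof -
  have h: "h \<in> form_domain"
    using assms by (simp add: perturbed_op_dom)
  have fp: "(\<lambda>j. functional h * (f j / p j)) \<in> form_domain"
    by (rule form_domain_scale[OF weighted_div_p(1)[OF f_weighted]])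
  have "shift_op perturbed_op \<mu> h j = p j * h j + functional h * f j" for j
    by (simp add: shift_op_def perturbed_op_apply[OF assms] algebra_simps)
  then have eq: "(\<lambda>j. shift_op perturbed_op \<mu> h j / p j) = (\<lambda>j. h j + functional h * (f j / p j))"
    by (simp add: add_divide_distrib)
  have "functional (\<lambda>j. h j + functional h * (f j / p j)) =
      functional h * (1 + functional (\<lambda>j. f j / p j))"
    unfolding functional_add[OF h fp] functional_scale by (simp add: algebra_simps)
  then show ?thesis
    using denominator_nz by (simp add: correction_def eq)
qed

lemma shift_bij:
  shows "bij_betw (shift_op perturbed_op \<mu>) (dom perturbed_op) l2"
    and "u \<in> l2 \<Longrightarrow> resolvent perturbed_op \<mu> u = correction (\<lambda>j. u j / p j)"
proof -
  have inv: "correction (\<lambda>j. u j / p j) \<in> dom perturbed_op"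
    "shift_op perturbed_op \<mu> (correction (\<lambda>j. u j / p j)) = u" if "u \<in> l2" for u
    using perturbed_op_correction[OF weighted_div_p(1)[OF l2_div_weight(1)[OF that R_pos]]] that by simp_all
  have maps: "shift_op perturbed_op \<mu> h \<in> l2" if "h \<in> dom perturbed_op" for h
  proof -
    have "h \<in> l2" "the (perturbed_op h) \<in> l2"
      using that form_domain_l2 by (auto simp: perturbed_op_apply perturbed_op_dom)
    then show ?thesis
      unfolding shift_op_def by (intro l2_diff l2_scale)
  qed
  show bij: "bij_betw (shift_op perturbed_op \<mu>) (dom perturbed_op) l2"
    by (rule bij_betw_byWitness[where f' = "\<lambda>u. correction (\<lambda>j. u j / p j)"])
      (use inv inverse_shift maps in \<open>simp_all add: image_subset_iff\<close>)
  show "resolvent perturbed_op \<mu> u = correction (\<lambda>j. u j / p j)" if "u \<in> l2"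
    unfolding resolvent_def
    by (rule inv_into_f_eq) (use bij inv[OF that] in \<open>auto simp: bij_betw_def\<close>)
qed

text \<open>
  Besides bounding the rank-one part of the resolvent, this shows that the correction disappears
  as \<open>\<mu>\<close> moves away from the vertex, which gives density of the domain.
\<close>

lemma norm_correction:
  assumes "k \<in> form_domain"
  shows "l2_norm (\<lambda>j. k j - correction k j) \<le> cmod (functional k) / sqrt \<nu>"
proof -
  let ?c = "functional k / (1 + functional (\<lambda>i. f i / p i))"
  have "(\<lambda>j. k j - correction k j) = (\<lambda>j. ?c * (f j / p j))"
    by (simp add: correction_def)
  then have "l2_norm (\<lambda>j. k j - correction k j) \<le> cmod ?c * l2_norm (\<lambda>j. f j / p j)"
    using l2_scale(2)[OF norm_div_p(1)[OF f_weighted], of ?c] by simp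
  also have "\<dots> \<le> (cmod (functional k) * 2) * (1 / 2 / sqrt \<nu>)"
  proof (intro mult_mono)
    show "cmod ?c \<le> cmod (functional k) * 2"
    proof -
      have "cmod (functional k) * 1 \<le> cmod (functional k) * (2 * cmod (1 + functional (\<lambda>i. f i / p i)))"
        using denominator by (intro mult_left_mono) auto
      then show ?thesis
        using denominator_nz by (simp add: norm_divide field_simps)
    qed
    have "l2_norm (\<lambda>j. f j / w j) / sqrt \<nu> \<le> 1 / 2 / sqrt \<nu>"
      using f_small by (intro divide_right_mono) auto
    then show "l2_norm (\<lambda>j. f j / p j) \<le> 1 / 2 / sqrt \<nu>"
      using norm_div_p(2)[OF f_weighted] by simp
  qed (auto intro: l2_norm_nonneg)
  finally show ?thesis
    by simp
qed

lemma resolvent_bound: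
  assumes u: "u \<in> l2"
  shows "l2_norm (resolvent perturbed_op \<mu> u) \<le> 5 / 2 / \<nu> * l2_norm u"
proof -
  define k where "k j = u j / p j" for j
  have k: "k \<in> form_domain"
    unfolding k_def by (rule weighted_div_p(1)[OF l2_div_weight(1)[OF u R_pos]])
  have "l2_norm k \<le> 2 / \<nu> * l2_norm u"
  proof (rule l2_dominated(2)[OF u])
    show "cmod (k j) \<le> 2 / \<nu> * cmod (u j)" for j
    proof -
      have "\<nu> \<le> 2 * cmod (p j)"
        using p_ge[of j] zero_le_power2[of "weight lam R j"] by argo
      then have "cmod (u j) * \<nu> \<le> cmod (u j) * (2 * cmod (p j))"
        by (intro mult_left_mono) auto
      then show ?thesis
        using nu_pos p_nz[of j] by (simp add: k_def norm_divide field_simps del: p_nz)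
    qed
  qed (use nu_pos in simp)
  moreover have "cmod (functional k) \<le> l2_norm u / (2 * sqrt \<nu>)"
  proof -
    have gp: "(\<lambda>j. g j / p j) \<in> l2" "l2_norm (\<lambda>j. g j / p j) \<le> 1 / 2 / sqrt \<nu>"
    proof -
      have "l2_norm (\<lambda>j. g j / w j) / sqrt \<nu> \<le> 1 / 2 / sqrt \<nu>"
        using g_small by (intro divide_right_mono) auto
      then show "(\<lambda>j. g j / p j) \<in> l2" "l2_norm (\<lambda>j. g j / p j) \<le> 1 / 2 / sqrt \<nu>"
        using norm_div_p[OF g_weighted] by auto
    qed
    have "cmod (functional k) \<le> l2_norm u * l2_norm (\<lambda>j. g j / p j)"
      unfolding functional_def
      by (rule l2_pairing(2)[OF u gp(1)]) (simp add: k_def norm_mult norm_divide)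
    also have "\<dots> \<le> l2_norm u * (1 / 2 / sqrt \<nu>)"
      by (intro mult_left_mono gp l2_norm_nonneg)
    finally show ?thesis
      by simp
  qed
  then have decay: "cmod (functional k) / sqrt \<nu> \<le> l2_norm u / (2 * sqrt \<nu>) / sqrt \<nu>"
    by (intro divide_right_mono) auto
  have "l2_norm u / (2 * sqrt \<nu>) / sqrt \<nu> = l2_norm u / (2 * \<nu>)"
    by simp
  with decay have "l2_norm (\<lambda>j. k j - correction k j) \<le> l2_norm u / (2 * \<nu>)"
    using norm_correction[OF k] by linarith
  moreover have "l2_norm (correction k) \<le> l2_norm k + l2_norm (\<lambda>j. k j - correction k j)"
  proof -
    have "k \<in> l2" "(\<lambda>j. k j - correction k j) \<in> l2"
      using k correction_form_domain(1)[OF k] form_domain_l2 by (auto intro: l2_diff)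
    from l2_diff(2)[OF this] show ?thesis
      by simp
  qed
  ultimately have "l2_norm (correction k) \<le> 2 / \<nu> * l2_norm u + l2_norm u / (2 * \<nu>)"
    by linarith
  also have "\<dots> = 5 / 2 / \<nu> * l2_norm u"
    by (simp add: field_simps)
  finally show ?thesis
    using shift_bij(2)[OF u] by (simp add: k_def[abs_def])
qed

lemma resolvent_estimate:
  shows "\<mu> \<in> resolvent_set perturbed_op"
    and "l2_onorm (resolvent perturbed_op \<mu>) \<le> 5 / 2 / \<nu>"
proof -
  show "\<mu> \<in> resolvent_set perturbed_op"
    unfolding resolvent_set_def using shift_bij(1) resolvent_bound by blast
  show "l2_onorm (resolvent perturbed_op \<mu>) \<le> 5 / 2 / \<nu>"
    unfolding l2_onorm_def
  proof (rule cSUP_least)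
    have "(\<lambda>_. 0) \<in> l2" "l2_norm (\<lambda>_. 0) \<le> 1"
      by (auto simp: l2_norm_def intro: l2_finite_support[of "{}"])
    then show "{u \<in> l2. l2_norm u \<le> 1} \<noteq> {}"
      by blast
    show "l2_norm (resolvent perturbed_op \<mu> u) \<le> 5 / 2 / \<nu>" if "u \<in> {u \<in> l2. l2_norm u \<le> 1}" for u
    proof -
      have "5 / 2 / \<nu> * l2_norm u \<le> 5 / 2 / \<nu> * 1"
        using that nu_pos by (intro mult_left_mono) auto
      then show ?thesis
        using resolvent_bound[of u] that by simp
    qed
  qed
qed

end

lemma Arg_left_of_vertex:
  assumes "0 < t"
  shows "pi / 3 \<le> \<bar>Arg (complex_of_real (- R - t) - complex_of_real (- R))\<bar>"
proof -
  have "complex_of_real (- R - t) - complex_of_real (- R) = complex_of_real (- t)"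
    by simp
  then show ?thesis
    using assms by (simp only: Arg_of_real) simp
qed

text \<open>
  A finitely supported vector need not lie in the domain, since \<open>f\<close> need not be in
  \<open>\<ell>\<^sup>2\<close>; its correction does, and is close to it for \<open>\<mu>\<close> far to the left.
\<close>

lemma densely_defined_perturbed_op: "densely_defined perturbed_op"
  unfolding densely_defined_def
proof (intro ballI allI impI)
  fix h :: "'j \<Rightarrow> complex" and \<epsilon> :: real
  assume h: "h \<in> l2" and "0 < \<epsilon>"
  then obtain F where F: "finite F" "l2_norm (\<lambda>j. h j - (if j \<in> F then h j else 0)) < \<epsilon> / 2"
    using l2_truncation[OF h, of "\<epsilon> / 2"] by auto
  define k where "k j = (if j \<in> F then h j else 0)" for j
  have k: "k \<in> form_domain"
    by (rule form_domain_finite_support[OF F(1)]) (simp add: k_def)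
  \<comment> \<open>Large enough for the bound \<open>cmod (functional k) / sqrt t\<close> to be at most \<open>\<epsilon> / 2\<close>.\<close>
  define t where "t = (2 * cmod (functional k) / \<epsilon> + 1)\<^sup>2"
  have root: "0 < 2 * cmod (functional k) / \<epsilon> + 1"
    using \<open>0 < \<epsilon>\<close> by (intro add_nonneg_pos) auto
  then have t: "0 < t"
    by (simp add: t_def)
  note off = Arg_left_of_vertex[OF t]
  let ?\<mu> = "complex_of_real (- R - t)"
  let ?k = "correction ?\<mu> k"
  have nu: "cmod (?\<mu> - complex_of_real (- R)) = t"
    using t by (simp flip: of_real_diff of_real_add of_real_minus)
  have "?k \<in> dom perturbed_op"
    by (rule perturbed_op_correction(1)[OF off k], rule l2_finite_support[OF F(1)]) (simp add: k_def)
  moreover have "l2_norm (\<lambda>j. h j - ?k j) < \<epsilon>"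
  proof -
    have "l2_norm (\<lambda>j. k j - ?k j) \<le> cmod (functional k) / sqrt t"
      using norm_correction[OF off k] unfolding nu .
    also have "\<dots> \<le> \<epsilon> / 2"
    proof -
      have "sqrt t = 2 * cmod (functional k) / \<epsilon> + 1"
        using root by (simp add: t_def)
      then show ?thesis
        using t \<open>0 < \<epsilon>\<close> by (simp add: field_simps)
    qed
    finally have small: "l2_norm (\<lambda>j. k j - ?k j) \<le> \<epsilon> / 2" .
    have "k \<in> l2" "?k \<in> l2"
      using k correction_form_domain(1)[OF off k] form_domain_l2 by auto
    then have "l2_norm (\<lambda>j. (h j - k j) + (k j - ?k j))
        \<le> l2_norm (\<lambda>j. h j - k j) + l2_norm (\<lambda>j. k j - ?k j)"
      using h by (intro l2_add l2_diff)
    then show ?thesis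
      using small F(2) by (simp add: k_def)
  qed
  ultimately show "\<exists>k\<in>dom perturbed_op. l2_norm (\<lambda>j. h j - k j) < \<epsilon>"
    by blast
qed

lemma sectorial_perturbed_op: "sectorial_op_with perturbed_op (pi / 3) (- R)"
  unfolding sectorial_op_with_def
  using linear_perturbed_op densely_defined_perturbed_op resolvent_estimate
  by (intro conjI exI[of _ "5 / 2 :: real"]) auto

section \<open>Uniqueness\<close>

text \<open>
  Unit vectors belong to the form domain, so the form identity determines every coordinate of
  \<open>T h\<close>; since \<open>T h\<close> lies in \<open>\<ell>\<^sup>2\<close>, the vector \<open>h\<close> meets the domain condition of
  \<open>perturbed_op\<close>.
\<close>

lemma represents_form_imp_perturbed_op:
  assumes T: "linear_op T" "dom T \<subseteq> form_domain"
    and repr: "\<And>h k. h \<in> dom T \<Longrightarrow> k \<in> form_domain \<Longrightarrow>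
      diag_form lam h k + rank_one_form f g h k = l2_inner (the (T h)) k"
    and h: "h \<in> dom T"
  shows "perturbed_op h = T h"
proof -
  have hD: "h \<in> form_domain"
    using T(2) h by blast
  have entry: "the (T h) i = complex_of_real (cmod (lam i)) * h i + functional h * f i" for i
  proof -
    let ?e = "\<lambda>j. if j = i then 1 else 0 :: complex"
    have e: "?e \<in> form_domain"
      by (rule form_domain_finite_support[of "{i}"]) auto
    have single: "(\<Sum>\<^sub>\<infinity>j. x j * cnj (?e j)) = x i" for x :: "'j \<Rightarrow> complex"
    proof -
      have "(\<Sum>\<^sub>\<infinity>j. x j * cnj (?e j)) = (\<Sum>\<^sub>\<infinity>j\<in>{i}. x j * cnj (?e j))"
        by (rule infsum_cong_neutral) auto
      then show ?thesis
        by simp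
    qed
    have "diag_form lam h ?e = complex_of_real (cmod (lam i)) * h i"
      using diag_form_eq(2)[of h lam ?e] hD e single by (simp add: form_domain_dom)
    then show ?thesis
      using repr[OF h e] single by (simp add: rank_one_form_eq l2_inner_def)
  qed
  obtain v where v: "T h = Some v"
    using h by blast
  then have "v \<in> l2"
    using T(1) by (auto simp: linear_op_def ran_def)
  moreover have "v = (\<lambda>j. complex_of_real (cmod (lam j)) * h j + functional h * f j)"
    using entry v by auto
  ultimately show ?thesis
    using v hD by (simp add: perturbed_op_def Let_def)
qed

lemma perturbed_op_unique:
  assumes "sectorial_op T" "dom T \<subseteq> form_domain"
    and repr: "\<And>h k. h \<in> dom T \<Longrightarrow> k \<in> form_domain \<Longrightarrow>
      diag_form lam h k + rank_one_form f g h k = l2_inner (the (T h)) k"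
  shows "T = perturbed_op"
proof -
  obtain \<theta> a M where T: "linear_op T" "\<theta> < pi / 2"
    and res: "\<And>\<mu>. \<theta> \<le> \<bar>Arg (\<mu> - complex_of_real a)\<bar> \<Longrightarrow> \<mu> \<in> resolvent_set T"
    using assms(1) unfolding sectorial_op_def sectorial_op_with_def by blast
  \<comment> \<open>The point \<open>- R - t\<close> lies to the left of both vertices, \<open>a\<close> and \<open>- R\<close>.\<close>
  define t where "t = \<bar>a\<bar> + 1"
  define \<mu> where "\<mu> = complex_of_real (- R - t)"
  have "\<mu> - complex_of_real a = complex_of_real (- R - t - a)" "- R - t - a < 0"
    using R_pos by (auto simp: \<mu>_def t_def)
  then have "Arg (\<mu> - complex_of_real a) = pi"
    by (simp only: Arg_of_real) simp
  then have "\<mu> \<in> resolvent_set T"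
    using T(2) pi_gt_zero by (intro res) linarith
  then have surj: "shift_op T \<mu> ` dom T = l2"
    by (auto simp: resolvent_set_def bij_betw_def)
  have "0 < t"
    by (simp add: t_def)
  then have bij: "bij_betw (shift_op perturbed_op \<mu>) (dom perturbed_op) l2"
    unfolding \<mu>_def by (intro shift_bij(1) Arg_left_of_vertex)
  have ext: "perturbed_op h = T h" if "h \<in> dom T" for h
    by (rule represents_form_imp_perturbed_op[OF T(1) assms(2) repr that])
  have dom: "h \<in> dom T" if h: "h \<in> dom perturbed_op" for h
  proof -
    have "shift_op perturbed_op \<mu> h \<in> l2"
      using bij h by (auto simp: bij_betw_def)
    then obtain h' where h': "h' \<in> dom T" "shift_op T \<mu> h' = shift_op perturbed_op \<mu> h"
      using surj by (metis imageE)
    have "shift_op T \<mu> h' = shift_op perturbed_op \<mu> h'"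
      using ext[OF h'(1)] by (simp add: shift_op_def)
    moreover have "h' \<in> dom perturbed_op"
      using h'(1) ext[OF h'(1)] by (simp add: domIff)
    ultimately have "h' = h"
      using bij h h'(2) by (auto simp: bij_betw_def dest: inj_onD)
    with h'(1) show ?thesis
      by simp
  qed
  show ?thesis
  proof
    fix h
    show "T h = perturbed_op h"
      by (metis ext dom domIff)
  qed
qed

end

theorem theorem7p7:
  fixes lam f g :: "'j::{countable, preorder} \<Rightarrow> complex"
    and \<theta> \<beta>\<^sub>0 :: real
  assumes "infinite (UNIV :: 'j set)"
    and "\<forall>i j :: 'j. \<exists>k. i \<le> k \<and> j \<le> k"
    and "sectorial_op_with (diag_op lam) \<theta> 0"
    and "\<beta>\<^sub>0 > 0"
    and "(\<lambda>j. (cmod (f j))\<^sup>2 / (sqrt (cmod (lam j)) + \<beta>\<^sub>0)\<^sup>2) summable_on UNIV"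
    and "(\<lambda>j. (cmod (g j))\<^sup>2 / (sqrt (cmod (lam j)) + \<beta>\<^sub>0)\<^sup>2) summable_on UNIV"
  shows "(\<forall>h \<in> dom (sqrt_abs_diag_op lam). \<forall>k \<in> dom (sqrt_abs_diag_op lam).
            (\<lambda>j. h j * cnj (g j)) summable_on UNIV \<and> (\<lambda>j. f j * cnj (k j)) summable_on UNIV) \<and>
         sectorial_form (dom (sqrt_abs_diag_op lam))
            (\<lambda>h k. diag_form lam h k + rank_one_form f g h k) \<and>
         (\<exists>!T. sectorial_op T \<and> dom T \<subseteq> dom (sqrt_abs_diag_op lam) \<and>
            (\<forall>h \<in> dom T. \<forall>k \<in> dom (sqrt_abs_diag_op lam).
               diag_form lam h k + rank_one_form f g h k = l2_inner (the (T h)) k))"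

proof -
  obtain R\<^sub>f where Rf: "\<And>R. R\<^sub>f \<le> R \<Longrightarrow> 0 < R \<Longrightarrow>
      (\<lambda>j. f j / complex_of_real (weight lam R j)) \<in> l2 \<and>
      l2_norm (\<lambda>j. f j / complex_of_real (weight lam R j)) \<le> 1 / 2"
    using weighted_norm_small[OF assms(4,5)] by blast
  obtain R\<^sub>g where Rg: "\<And>R. R\<^sub>g \<le> R \<Longrightarrow> 0 < R \<Longrightarrow>
      (\<lambda>j. g j / complex_of_real (weight lam R j)) \<in> l2 \<and>
      l2_norm (\<lambda>j. g j / complex_of_real (weight lam R j)) \<le> 1 / 2"
    using weighted_norm_small[OF assms(4,6)] by blast
  define R where "R = max 1 (max R\<^sub>f R\<^sub>g)"
  interpret small_rank_one_perturbation lam f g R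
    by unfold_locales (use Rf[of R] Rg[of R] in \<open>auto simp: R_def\<close>)
  have "\<exists>!T. sectorial_op T \<and> dom T \<subseteq> form_domain \<and> (\<forall>h \<in> dom T. \<forall>k \<in> form_domain.
      diag_form lam h k + rank_one_form f g h k = l2_inner (the (T h)) k)"
  proof (rule ex1I[of _ perturbed_op])
    show "sectorial_op perturbed_op \<and> dom perturbed_op \<subseteq> form_domain \<and>
      (\<forall>h \<in> dom perturbed_op. \<forall>k \<in> form_domain.
        diag_form lam h k + rank_one_form f g h k = l2_inner (the (perturbed_op h)) k)"
      using sectorial_perturbed_op perturbed_op_represents_form
      by (auto simp: sectorial_op_def perturbed_op_dom)
  qed (auto intro: perturbed_op_unique)
  then show ?thesis
    unfolding form_domain_dom
    using pairing_f(1) pairing_g(1) sectorial_perturbed_form by blast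
qed

end
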